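(* Let $u^0\in K$ and let $(u^n)_{n\ge 1}$ be a sequence in $K$ such that $u^n\in \operatorname{argmin}_{u\in K} E_Q(u;u^{n-1})$ for every $n=1,2,3,\ldots$. Then for every $n\ge 1$, $$E(u^n)\leq E(u^{n-1}).$$
   Context: Let $\Omega\subset\mathbb{R}^d$, $d\in\{2,3\}$, be a domain and let $\epsilon>0$. Set $$K:=\{u\in H^1(\Omega) : |u|\le 1 \text{ a.e. in } \Omega\},$$ a nonempty closed convex subset of the real Sobolev space $H^1(\Omega)$. The double-well energy functional is $$E(u):=\int_\Omega \frac12|\nabla u|^2+\frac{1}{\epsilon^2}F(u)\,\mathrm{d}x,\qquad F(u)=\frac14(u^2-1)^2 .$$ Put $p(u)=\frac12(u^2-1)$, so that $F(u)=p(u)^2$. For a given function $w$, let $p_L(u;w)$ be the linear expansion of $p$ at $w$, $$p_L(u;w)=p(w)+p'(w)(u-w)=wu-\frac12 w^2-\frac12 ,$$ and define the quadratic functional (in $u$) $$E_Q(u;w)=\int_\Omega \frac12|\nabla u|^2+\frac{1}{\epsilon^2}\,p_L(u;w)^2\,\mathrm{d}x=\int_\Omega \frac12|\nabla u|^2+\frac1{\epsilon^2}\Big(wu-\frac12w^2-\frac12\Big)^2\mathrm{d}x .$$ Here $\operatorname{argmin}_{u\in K}E_Q(u;w)$ denotes the set of minimizers of $E_Q(\cdot;w)$ over $K$. *)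

theory Defs
  imports "HOL-Analysis.Analysis"
begin

text \<open>Elements of \<open>L\<^sup>2(\<Omega>)\<close> and \<open>H\<^sup>1(\<Omega>)\<close> are represented by functions on the whole space; only their values
  almost everywhere in \<open>\<Omega>\<close> matter (see \<open>weak_grad_cong_AE\<close> and \<open>energy_cong_AE\<close> below).\<close>

definition domain_set :: "'a::topological_space set \<Rightarrow> bool" where
  "domain_set \<Omega> \<longleftrightarrow> open \<Omega> \<and> connected \<Omega> \<and> \<Omega> \<noteq> {}"

definition L2 :: "'a::euclidean_space set \<Rightarrow> ('a \<Rightarrow> real) set" where
  "L2 \<Omega> = {u \<in> borel_measurable (lebesgue_on \<Omega>). integrable (lebesgue_on \<Omega>) (\<lambda>x. (u x)\<^sup>2)}"

definition pderivative :: "'n::finite \<Rightarrow> (real^'n \<Rightarrow> real) \<Rightarrow> real^'n \<Rightarrow> real" where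
  "pderivative i f x = frechet_derivative f (at x) (axis i 1)"

primrec C_diff :: "nat \<Rightarrow> (real^'n::finite \<Rightarrow> real) \<Rightarrow> bool" where
  "C_diff 0 f \<longleftrightarrow> continuous_on UNIV f"
| "C_diff (Suc k) f \<longleftrightarrow> f differentiable_on UNIV \<and> (\<forall>i. C_diff k (pderivative i f))"

definition test_functions :: "(real^'n::finite) set \<Rightarrow> (real^'n \<Rightarrow> real) set" where
  "test_functions \<Omega> = {\<phi>. (\<forall>k. C_diff k \<phi>) \<and>
     compact (closure {x. \<phi> x \<noteq> 0}) \<and> closure {x. \<phi> x \<noteq> 0} \<subseteq> \<Omega>}"

definition is_weak_grad ::
    "(real^'n::finite) set \<Rightarrow> (real^'n \<Rightarrow> real) \<Rightarrow> (real^'n \<Rightarrow> real^'n) \<Rightarrow> bool" where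
  "is_weak_grad \<Omega> u g \<longleftrightarrow> (\<forall>i. (\<lambda>x. g x $ i) \<in> L2 \<Omega>) \<and>
     (\<forall>\<phi>\<in>test_functions \<Omega>. \<forall>i.
        (\<integral>x. u x * pderivative i \<phi> x \<partial>lebesgue_on \<Omega>) = - (\<integral>x. g x $ i * \<phi> x \<partial>lebesgue_on \<Omega>))"

definition H1 :: "(real^'n::finite) set \<Rightarrow> (real^'n \<Rightarrow> real) set" where
  "H1 \<Omega> = {u \<in> L2 \<Omega>. \<exists>g. is_weak_grad \<Omega> u g}"

text \<open>The weak gradient of \<open>u \<in> H\<^sup>1(\<Omega>)\<close> is unique up to null sets, so the choice of a representative is
  immaterial.\<close>

definition weak_grad :: "(real^'n::finite) set \<Rightarrow> (real^'n \<Rightarrow> real) \<Rightarrow> real^'n \<Rightarrow> real^'n" where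
  "weak_grad \<Omega> u = (SOME g. is_weak_grad \<Omega> u g)"

definition K :: "(real^'n::finite) set \<Rightarrow> (real^'n \<Rightarrow> real) set" where
  "K \<Omega> = {u \<in> H1 \<Omega>. AE x in lebesgue_on \<Omega>. \<bar>u x\<bar> \<le> 1}"

definition F :: "real \<Rightarrow> real" where
  "F u = 1/4 * (u\<^sup>2 - 1)\<^sup>2"

definition p :: "real \<Rightarrow> real" where
  "p u = 1/2 * (u\<^sup>2 - 1)"

definition p_L :: "real \<Rightarrow> real \<Rightarrow> real" where
  "p_L u w = p w + deriv p w * (u - w)"

text \<open>Both integrands are nonnegative, so the functionals are taken with values in \<open>[0,\<infinity>]\<close>; the value
  \<open>\<infinity>\<close> can occur on \<open>K\<close> only if \<open>\<Omega>\<close> has infinite measure.\<close>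

definition energy :: "(real^'n::finite) set \<Rightarrow> real \<Rightarrow> (real^'n \<Rightarrow> real) \<Rightarrow> ennreal" where
  "energy \<Omega> \<epsilon> u =
     (\<integral>\<^sup>+x. ennreal (1/2 * (norm (weak_grad \<Omega> u x))\<^sup>2 + 1/\<epsilon>\<^sup>2 * F (u x)) \<partial>lebesgue_on \<Omega>)"

definition energy_Q ::
    "(real^'n::finite) set \<Rightarrow> real \<Rightarrow> (real^'n \<Rightarrow> real) \<Rightarrow> (real^'n \<Rightarrow> real) \<Rightarrow> ennreal" where
  "energy_Q \<Omega> \<epsilon> u w =
     (\<integral>\<^sup>+x. ennreal (1/2 * (norm (weak_grad \<Omega> u x))\<^sup>2 + 1/\<epsilon>\<^sup>2 * (p_L (u x) (w x))\<^sup>2)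
        \<partial>lebesgue_on \<Omega>)"

definition argmin_on :: "'a set \<Rightarrow> ('a \<Rightarrow> 'b::ord) \<Rightarrow> 'a set" where
  "argmin_on S f = {x. is_arg_min f (\<lambda>y. y \<in> S) x}"

lemma F_eq_p_squared: "F u = (p u)\<^sup>2"
  by (simp add: F_def p_def power2_eq_square)

lemma p_L_eq: "p_L u w = w * u - 1/2 * w\<^sup>2 - 1/2"
proof -
  have "(p has_field_derivative w) (at w)"
    unfolding p_def by (auto intro!: derivative_eq_intros)
  then have "deriv p w = w"
    by (rule DERIV_imp_deriv)
  then show ?thesis
    by (simp add: p_L_def p_def power2_eq_square field_simps)
qed

lemma weak_grad_cong_AE:
  assumes "u \<in> borel_measurable (lebesgue_on \<Omega>)" "v \<in> borel_measurable (lebesgue_on \<Omega>)"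
    and "AE x in lebesgue_on \<Omega>. u x = v x" and "\<Omega> \<in> sets lebesgue"
  shows "weak_grad \<Omega> u = weak_grad \<Omega> v"
proof -
  have "(\<integral>x. u x * pderivative i \<phi> x \<partial>lebesgue_on \<Omega>) = (\<integral>x. v x * pderivative i \<phi> x \<partial>lebesgue_on \<Omega>)"
    if "\<phi> \<in> test_functions \<Omega>" for \<phi> and i
  proof (rule integral_cong_AE)
    have "C_diff (Suc 0) \<phi>"
      using that unfolding test_functions_def by blast
    then have "continuous_on UNIV (pderivative i \<phi>)"
      by simp
    then have "pderivative i \<phi> \<in> borel_measurable (lebesgue_on \<Omega>)"
      by (meson assms(4) continuous_imp_measurable_on_sets_lebesgue continuous_on_subset subset_UNIV)
    then show "(\<lambda>x. u x * pderivative i \<phi> x) \<in> borel_measurable (lebesgue_on \<Omega>)"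
      "(\<lambda>x. v x * pderivative i \<phi> x) \<in> borel_measurable (lebesgue_on \<Omega>)"
      using assms by (auto intro: borel_measurable_times)
    show "AE x in lebesgue_on \<Omega>. u x * pderivative i \<phi> x = v x * pderivative i \<phi> x"
      using assms(3) by eventually_elim simp
  qed
  then have "is_weak_grad \<Omega> u = is_weak_grad \<Omega> v"
    by (auto simp: is_weak_grad_def fun_eq_iff)
  then show ?thesis
    by (simp add: weak_grad_def)
qed

lemma energy_cong_AE:
  assumes "u \<in> borel_measurable (lebesgue_on \<Omega>)" "v \<in> borel_measurable (lebesgue_on \<Omega>)"
    and "AE x in lebesgue_on \<Omega>. u x = v x" and "\<Omega> \<in> sets lebesgue"
  shows "energy \<Omega> \<epsilon> u = energy \<Omega> \<epsilon> v" and "energy_Q \<Omega> \<epsilon> u w = energy_Q \<Omega> \<epsilon> v w"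
  unfolding energy_def energy_Q_def weak_grad_cong_AE[OF assms]
  by (rule nn_integral_cong_AE, use assms(3) in eventually_elim, simp)+

end

theory Submission
  imports Defs
begin

text \<open>The quadratic model is a majorant of the energy on \<open>K\<close> that touches it at the expansion point.
  Indeed \<open>p\<close> is convex, so its tangent \<open>p_L(\<cdot>; w)\<close> lies below it; and \<open>p \<le> 0\<close> on \<open>[-1, 1]\<close>. Hence
  \<open>p_L v w \<le> p v \<le> 0\<close> whenever \<open>\<bar>v\<bar> \<le> 1\<close>, and squaring reverses the order, giving \<open>F v \<le> (p_L v w)\<^sup>2\<close>.
  Integrating, \<open>E(v) \<le> E\<^sub>Q(v; w)\<close> for every \<open>v \<in> K\<close>, with equality at \<open>v = w\<close>. If \<open>v\<close> minimizes
  \<open>E\<^sub>Q(\<cdot>; w)\<close> over \<open>K\<close> and \<open>w \<in> K\<close>, then \<open>E(v) \<le> E\<^sub>Q(v; w) \<le> E\<^sub>Q(w; w) = E(w)\<close>. This is the descent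
  argument of majorization-minimization schemes.\<close>

lemma p_L_self: "p_L w w = p w"
  by (simp add: p_L_def)

text \<open>Since \<open>p\<close> is quadratic, the gap \<open>p v - p_L v w\<close> is exactly the square \<open>(v - w)\<^sup>2 / 2\<close>.\<close>

lemma p_L_le_p: "p_L v w \<le> p v"
proof -
  have "p v = p_L v w + 1/2 * (v - w)\<^sup>2"
    by (simp add: p_L_eq p_def power2_eq_square field_simps)
  then show ?thesis
    by simp
qed

text \<open>The bound \<open>\<bar>v\<bar> \<le> 1\<close> makes \<open>p v\<close> nonpositive, and among nonpositive numbers the smaller one has
  the larger square; for \<open>\<bar>v\<bar> > 1\<close> the inequality can fail.\<close>

lemma F_le_p_L_squared:
  assumes "\<bar>v\<bar> \<le> 1"
  shows "F v \<le> (p_L v w)\<^sup>2"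
proof -
  have "p v \<le> 0"
    using assms by (simp add: p_def abs_square_le_1)
  then have "(p v)\<^sup>2 \<le> (p_L v w)\<^sup>2"
    using p_L_le_p[of v w] by (simp add: abs_le_square_iff[symmetric])
  then show ?thesis
    by (simp add: F_eq_p_squared)
qed

lemma energy_Q_self: "energy_Q \<Omega> \<epsilon> w w = energy \<Omega> \<epsilon> w"
  by (simp add: energy_Q_def energy_def p_L_self F_eq_p_squared)

lemma energy_le_energy_Q:
  assumes "v \<in> K \<Omega>"
  shows "energy \<Omega> \<epsilon> v \<le> energy_Q \<Omega> \<epsilon> v w"
proof -
  have "AE x in lebesgue_on \<Omega>. \<bar>v x\<bar> \<le> 1"
    using assms by (simp add: K_def)
  then show ?thesis
    unfolding energy_def energy_Q_def
  proof (intro nn_integral_mono_AE, eventually_elim)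
    case (elim x)
    then have "1/\<epsilon>\<^sup>2 * F (v x) \<le> 1/\<epsilon>\<^sup>2 * (p_L (v x) (w x))\<^sup>2"
      by (intro mult_left_mono F_le_p_L_squared) simp_all
    then show ?case
      by (intro ennreal_leI add_left_mono)
  qed
qed

lemma energy_argmin_le:
  assumes "w \<in> K \<Omega>" and "v \<in> argmin_on (K \<Omega>) (\<lambda>v. energy_Q \<Omega> \<epsilon> v w)"
  shows "energy \<Omega> \<epsilon> v \<le> energy \<Omega> \<epsilon> w"
proof -
  have "v \<in> K \<Omega>" and "energy_Q \<Omega> \<epsilon> v w \<le> energy_Q \<Omega> \<epsilon> w w"
    using assms by (auto simp: argmin_on_def is_arg_min_linorder)
  then show ?thesis
    using energy_le_energy_Q[of v \<Omega> \<epsilon> w] by (simp add: energy_Q_self)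
qed

theorem theorem3p1:
  fixes \<Omega> :: "(real^'n::finite) set" and \<epsilon> :: real
    and u :: "nat \<Rightarrow> real^'n \<Rightarrow> real"
  assumes "CARD('n) \<in> {2, 3}"
    and "domain_set \<Omega>"
    and "\<epsilon> > 0"
    and "u 0 \<in> K \<Omega>"
    and "\<And>n. n \<ge> 1 \<Longrightarrow> u n \<in> K \<Omega>"
    and "\<And>n. n \<ge> 1 \<Longrightarrow> u n \<in> argmin_on (K \<Omega>) (\<lambda>v. energy_Q \<Omega> \<epsilon> v (u (n - 1)))"
  shows "\<forall>n\<ge>1. energy \<Omega> \<epsilon> (u n) \<le> energy \<Omega> \<epsilon> (u (n - 1))"
proof (intro allI impI)
  fix n :: nat
  assume "n \<ge> 1"
  have "u (n - 1) \<in> K \<Omega>"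
    using assms(4,5) by (cases "n - 1 = 0") simp_all
  then show "energy \<Omega> \<epsilon> (u n) \<le> energy \<Omega> \<epsilon> (u (n - 1))"
    using assms(6)[OF \<open>n \<ge> 1\<close>] by (rule energy_argmin_le)
qed

end
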